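(* Let $m$ be an integer and $n$ a nonnegative integer. Then the generalized Bernoulli numbers $B_n^{(m)}$ satisfy $$\frac{1}{n!} B_{n}^{(m)}=\sum_{\substack{k_1+k_2+\cdots+k_n=l \\ k_1+2k_2+\cdots+nk_n=n}}(-1)^{l}\binom{m+l-1}{l}\frac{l!}{k_1!k_2!\cdots k_n!}\prod_{i=1}^{n}\left(\frac{1}{(i+1)!}\right)^{k_{i}}.$$
   Context: For any integer $m$, the generalized Bernoulli numbers $B_n^{(m)}$ are defined by the formal power series identity $\left(1+\sum_{n\geq 1}\frac{1}{(n+1)!}X^{n}\right)^{-m}=1+\sum_{n\geq 1}\frac{1}{n!}B_{n}^{(m)}X^{n}$, with $B_0^{(m)}=1$. The sum runs over all tuples of nonnegative integers $(k_1,\ldots,k_n)$ with $k_1+2k_2+\cdots+nk_n=n$, where $l=k_1+\cdots+k_n$ (for $n=0$ there is only the empty tuple, with $l=0$). Binomial coefficients are generalized: $\binom{x}{l}=x(x-1)\cdots(x-l+1)/l!$ for any integer $x$ and $l\ge0$. *)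

theory Defs
  imports "HOL-Computational_Algebra.Formal_Power_Series" "HOL-Library.FuncSet"
begin

text \<open>
  The series \<open>1 + (\<Sum>n\<ge>1. X^n / (n+1)!)\<close>. Its constant term is \<open>1\<close>, so the total function
  \<open>inverse\<close> on \<open>rat fps\<close>, and with it \<open>powi\<close> for negative exponents, is the genuine inverse.
\<close>
definition bernoulli_base :: "rat fps" where
  "bernoulli_base = 1 + Abs_fps (\<lambda>n. if n = 0 then 0 else 1 / fact (n + 1))"

text \<open>
  The numbers are read off as coefficients; the lemmas below give back the defining
  power series identity.
\<close>
definition gen_bernoulli :: "int \<Rightarrow> nat \<Rightarrow> rat" where
  "gen_bernoulli m n = fact n * fps_nth (bernoulli_base powi (- m)) n"

text \<open>
  Tuples \<open>(k\<^sub>1, \<dots>, k\<^sub>n)\<close> are extensional functions on \<open>{1..n}\<close>, so that distinct functions are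
  distinct tuples; for \<open>n = 0\<close> there is exactly one.
\<close>
definition weight_tuples :: "nat \<Rightarrow> (nat \<Rightarrow> nat) set" where
  "weight_tuples n = {k \<in> {1..n} \<rightarrow>\<^sub>E UNIV. (\<Sum>i=1..n. i * k i) = n}"

lemma bernoulli_base_nth_0 [simp]: "fps_nth bernoulli_base 0 = 1"
  by (simp add: bernoulli_base_def)

lemma bernoulli_base_inverse: "bernoulli_base * inverse bernoulli_base = 1"
  by (simp add: inverse_mult_eq_1')

lemma gen_bernoulli_0: "gen_bernoulli m 0 = 1"
  by (simp add: gen_bernoulli_def power_int_def fps_nth_power_0)

lemma gen_bernoulli_identity:
  "bernoulli_base powi (- m) =
     1 + Abs_fps (\<lambda>n. if n = 0 then 0 else 1 / fact n * gen_bernoulli m n)"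
  using gen_bernoulli_0[of m]
  by (intro fps_ext) (auto simp: gen_bernoulli_def)

lemma finite_weight_tuples: "finite (weight_tuples n)"
proof (rule finite_subset)
  show "weight_tuples n \<subseteq> {1..n} \<rightarrow>\<^sub>E {..n}"
  proof
    fix k assume k: "k \<in> weight_tuples n"
    have "k i \<le> n" if i: "i \<in> {1..n}" for i
    proof -
      have "k i \<le> i * k i" using i by simp
      also have "\<dots> \<le> (\<Sum>j=1..n. j * k j)"
        using i by (intro member_le_sum) auto
      also have "\<dots> = n" using k by (simp add: weight_tuples_def)
      finally show ?thesis .
    qed
    then show "k \<in> {1..n} \<rightarrow>\<^sub>E {..n}"
      using k by (auto simp: weight_tuples_def PiE_iff)
  qed
  show "finite ({1..n} \<rightarrow>\<^sub>E {..n})" by (intro finite_PiE) auto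
qed

lemma weight_tuples_0: "weight_tuples 0 = {\<lambda>_. undefined}"
  by (auto simp: weight_tuples_def)

end

theory Submission
  imports Defs
begin

text \<open>
  Write the base series as \<open>1 + Y\<close>, where \<open>Y\<close> has constant term \<open>0\<close>. Newton's binomial series
  \<open>fps_binomial c = (\<Sum>l. (c gchoose l) X^l)\<close> is \<open>(1 + X)\<close> raised to the power \<open>c\<close>, so the
  generating function \<open>(1 + Y) powi (- m)\<close> is the composition of \<open>fps_binomial (- m)\<close> with \<open>Y\<close>
  (\<open>one_plus_powi_eq_binomial_compose\<close>).

  The coefficients of any composition \<open>a oo b\<close> are given by the ordinary-power-series form of Faa di
  Bruno's formula (\<open>fps_compose_nth_weight_tuples\<close>): only \<open>b\<^sub>1, \<dots>, b\<^sub>n\<close> contribute to the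
  \<open>n\<close>-th coefficient, so each power \<open>b ^ l\<close> may be expanded by the multinomial theorem, and a term
  \<open>\<Prod>i. (b\<^sub>i X^i) ^ k\<^sub>i\<close> lives in degree \<open>\<Sum>i. i k\<^sub>i\<close>. Summing over \<open>l\<close> merges the tuples of
  total \<open>l\<close> and weight \<open>n\<close> into all tuples of weight \<open>n\<close>. The claim then follows from
  the reflection \<open>(- m gchoose l) = (-1) ^ l * (m + l - 1 gchoose l)\<close>.
\<close>

section \<open>The multinomial theorem\<close>

text \<open>
  As for \<^const>\<open>weight_tuples\<close>, extensionality makes the elements correspond exactly to the
  exponent vectors of the monomials of degree \<open>l\<close>.
\<close>
definition total_tuples :: "'i set \<Rightarrow> nat \<Rightarrow> ('i \<Rightarrow> nat) set" where
  "total_tuples A l = {k \<in> A \<rightarrow>\<^sub>E UNIV. (\<Sum>i\<in>A. k i) = l}"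

lemma finite_total_tuples:
  assumes "finite A"
  shows "finite (total_tuples A l)"
proof (rule finite_subset)
  show "total_tuples A l \<subseteq> A \<rightarrow>\<^sub>E {..l}"
    using assms by (auto simp: total_tuples_def PiE_iff extensional_def intro!: member_le_sum)
  show "finite (A \<rightarrow>\<^sub>E {..l})"
    using assms by (intro finite_PiE) auto
qed

text \<open>
  A tuple on \<open>insert a A\<close> is its value \<open>j\<close> at \<open>a\<close> together with a tuple on \<open>A\<close> of total
  \<open>l - j\<close>; the same splitting occurs on the other side of the multinomial theorem when the
  binomial theorem is applied to \<open>(x a + (\<Sum>i\<in>A. x i)) ^ l\<close>.
\<close>
lemma sum_total_tuples_insert:
  assumes "finite A" "a \<notin> A"
  shows "(\<Sum>k\<in>total_tuples (insert a A) l. F k) =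
    (\<Sum>j\<le>l. \<Sum>k\<in>total_tuples A (l - j). F (k(a := j)))"
proof -
  have upd: "(\<Sum>i\<in>A. (k(a := j)) i) = (\<Sum>i\<in>A. k i)" for k :: "'a \<Rightarrow> nat" and j
    using assms by (intro sum.cong) auto
  have "(\<Sum>j\<le>l. \<Sum>k\<in>total_tuples A (l - j). F (k(a := j))) =
      (\<Sum>(j, k)\<in>(SIGMA j:{..l}. total_tuples A (l - j)). F (k(a := j)))"
    using assms by (intro sum.Sigma) (auto simp: finite_total_tuples)
  also have "\<dots> = (\<Sum>k\<in>total_tuples (insert a A) l. F k)"
    using assms
    by (intro sum.reindex_bij_witness[where i = "\<lambda>k. (k a, k(a := undefined))"
          and j = "\<lambda>(j, k). k(a := j)"])
       (auto simp: total_tuples_def PiE_iff extensional_def fun_eq_iff upd simp del: fun_upd_apply,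
        auto)
  finally show ?thesis ..
qed

lemma prod_fact_dvd_fact_sum:
  assumes "finite A"
  shows "(\<Prod>i\<in>A. fact (k i)) dvd (fact (\<Sum>i\<in>A. k i) :: nat)"
  using assms
proof (induction A rule: finite_induct)
  case (insert a A)
  have "(\<Prod>i\<in>insert a A. fact (k i)) dvd (fact (k a) * fact (\<Sum>i\<in>A. k i) :: nat)"
    using insert by (simp add: mult_dvd_mono)
  also have "\<dots> dvd fact (k a + (\<Sum>i\<in>A. k i))"
    by (rule fact_fact_dvd_fact)
  finally show ?case
    using insert by simp
qed simp

theorem multinomial_theorem:
  fixes x :: "'i \<Rightarrow> 'a::comm_semiring_1"
  assumes "finite A"
  shows "(\<Sum>i\<in>A. x i) ^ l =
    (\<Sum>k\<in>total_tuples A l. of_nat (fact l div (\<Prod>i\<in>A. fact (k i))) * (\<Prod>i\<in>A. x i ^ k i))"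
  using assms
proof (induction A arbitrary: l rule: finite_induct)
  case empty
  show ?case
  proof (cases "l = 0")
    case True
    then have "total_tuples {} l = {\<lambda>_ :: 'i. undefined}"
      by (auto simp: total_tuples_def)
    then show ?thesis
      using True by simp
  qed (simp add: total_tuples_def power_0_left)
next
  case (insert a A)
  have coeff: "fact l div (\<Prod>i\<in>insert a A. fact ((k(a := j)) i)) =
      (l choose j) * (fact (l - j) div (\<Prod>i\<in>A. fact (k i)) :: nat)"
    if "j \<le> l" "k \<in> total_tuples A (l - j)" for j k
  proof -
    let ?P = "\<Prod>i\<in>A. fact (k i) :: nat"
    have dvd: "?P dvd fact (l - j)"
      using that prod_fact_dvd_fact_sum[OF insert.hyps(1), of k] by (simp add: total_tuples_def)
    have "(\<Prod>i\<in>insert a A. fact ((k(a := j)) i)) = fact j * ?P"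
      using insert.hyps by (simp, intro prod.cong) auto
    moreover have "fact l = fact j * ((l choose j) * fact (l - j) :: nat)"
      using binomial_fact_lemma[OF that(1)] by (simp add: algebra_simps)
    ultimately show ?thesis
      using dvd by (simp add: div_mult_swap)
  qed
  have monomial: "(\<Prod>i\<in>insert a A. x i ^ (k(a := j)) i) = x a ^ j * (\<Prod>i\<in>A. x i ^ k i)" for j k
    using insert.hyps by (simp, intro arg_cong2[where f = "(*)"] refl prod.cong) auto
  have "(\<Sum>i\<in>insert a A. x i) ^ l = (\<Sum>j\<le>l. of_nat (l choose j) * x a ^ j * (\<Sum>i\<in>A. x i) ^ (l - j))"
    using insert.hyps by (simp add: binomial_ring)
  also have "\<dots> = (\<Sum>j\<le>l. \<Sum>k\<in>total_tuples A (l - j).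
      of_nat ((l choose j) * (fact (l - j) div (\<Prod>i\<in>A. fact (k i)))) *
        (x a ^ j * (\<Prod>i\<in>A. x i ^ k i)))"
    by (simp add: insert.IH sum_distrib_left mult_ac)
  also have "\<dots> = (\<Sum>j\<le>l. \<Sum>k\<in>total_tuples A (l - j).
      of_nat (fact l div (\<Prod>i\<in>insert a A. fact ((k(a := j)) i))) *
        (\<Prod>i\<in>insert a A. x i ^ (k(a := j)) i))"
    by (intro sum.cong refl) (simp only: coeff monomial atMost_iff)
  also have "\<dots> = (\<Sum>k\<in>total_tuples (insert a A) l.
      of_nat (fact l div (\<Prod>i\<in>insert a A. fact (k i))) * (\<Prod>i\<in>insert a A. x i ^ k i))"
    by (rule sum_total_tuples_insert[OF insert.hyps, symmetric])
  finally show ?case .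
qed


section \<open>Coefficients of powers and compositions\<close>

unbundle fps_syntax

text \<open>Reduction modulo \<open>X ^ (n + 1)\<close> is compatible with products, hence with powers.\<close>
lemma fps_power_nth_cong:
  fixes f g :: "'a::semiring_1 fps"
  assumes "\<And>i. i \<le> n \<Longrightarrow> f $ i = g $ i"
  shows "f ^ l $ n = g ^ l $ n"
  using assms
proof (induction l arbitrary: n)
  case (Suc l)
  show ?case
    unfolding power_Suc fps_mult_nth
    using Suc.prems by (intro sum.cong arg_cong2[where f = "(*)"] Suc.IH) auto
qed simp

lemma prod_monomial_power:
  fixes c :: "nat \<Rightarrow> 'a::comm_semiring_1"
  shows "(\<Prod>i\<in>A. (fps_const (c i) * fps_X ^ i) ^ k i) =
    fps_const (\<Prod>i\<in>A. c i ^ k i) * fps_X ^ (\<Sum>i\<in>A. i * k i)"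
  by (induction A rule: infinite_finite_induct)
     (simp_all add: power_mult_distrib power_add power_mult[symmetric] mult_ac
        flip: fps_const_mult)

text \<open>
  Since \<open>b\<close> starts in degree \<open>1\<close>, it may be replaced by the polynomial
  \<open>\<Sum>i=1..n. b\<^sub>i X^i\<close>; in the multinomial expansion of its power, the terms of degree \<open>n\<close>
  are those whose exponent tuple has weight \<open>n\<close>.
\<close>
lemma fps_power_nth_weight_tuples:
  fixes b :: "'a::field_char_0 fps"
  assumes "b $ 0 = 0"
  shows "b ^ l $ n = (\<Sum>k\<in>{k \<in> weight_tuples n. (\<Sum>i=1..n. k i) = l}.
    fact l / (\<Prod>i=1..n. fact (k i)) * (\<Prod>i=1..n. (b $ i) ^ k i))"
proof -
  let ?T = "\<Sum>i=1..n. fps_const (b $ i) * fps_X ^ i"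
  let ?c = "\<lambda>k. fact l / (\<Prod>i=1..n. fact (k i)) * (\<Prod>i=1..n. (b $ i) ^ k i)"
  have trunc: "b $ j = ?T $ j" if "j \<le> n" for j
    using that assms by (cases "j = 0") (auto simp: fps_sum_nth if_distrib sum.delta cong: if_cong)
  have coeff: "of_nat (fact l div (\<Prod>i=1..n. fact (k i))) = (fact l / (\<Prod>i=1..n. fact (k i)) :: 'a)"
    if "k \<in> total_tuples {1..n} l" for k
  proof -
    have "(\<Prod>i=1..n. fact (k i)) dvd (fact l :: nat)"
      using prod_fact_dvd_fact_sum[of "{1..n}" k] that by (simp add: total_tuples_def)
    moreover have "of_nat (q div p) = (of_nat q / of_nat p :: 'a)" if "p dvd q" for p q :: nat
      using that by (cases "p = 0") auto
    ultimately show ?thesis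
      by simp
  qed
  have "b ^ l $ n = ?T ^ l $ n"
    by (rule fps_power_nth_cong) (rule trunc)
  also have "\<dots> = (\<Sum>k\<in>total_tuples {1..n} l.
      (of_nat (fact l div (\<Prod>i=1..n. fact (k i))) *
        (fps_const (\<Prod>i=1..n. (b $ i) ^ k i) * fps_X ^ (\<Sum>i=1..n. i * k i))) $ n)"
    by (simp only: multinomial_theorem finite_atLeastAtMost prod_monomial_power fps_sum_nth)
  also have "\<dots> = (\<Sum>k\<in>total_tuples {1..n} l. if (\<Sum>i=1..n. i * k i) = n then ?c k else 0)"
    by (intro sum.cong refl) (auto simp: coeff[simplified] fps_of_nat[symmetric])
  also have "\<dots> = (\<Sum>k\<in>{k \<in> total_tuples {1..n} l. (\<Sum>i=1..n. i * k i) = n}. ?c k)"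
    by (rule sum.inter_filter[symmetric]) (simp add: finite_total_tuples)
  also have "{k \<in> total_tuples {1..n} l. (\<Sum>i=1..n. i * k i) = n} =
      {k \<in> weight_tuples n. (\<Sum>i=1..n. k i) = l}"
    by (auto simp: total_tuples_def weight_tuples_def)
  finally show ?thesis .
qed

text \<open>
  Faa di Bruno's formula. A tuple of weight \<open>n\<close> has total at most \<open>n\<close>, because every index is at
  least \<open>1\<close>; so grouping the tuples by their total \<open>l\<close> accounts for all of them with \<open>l \<le> n\<close>,
  which is the range that the composition uses.
\<close>
theorem fps_compose_nth_weight_tuples:
  fixes a b :: "'a::field_char_0 fps"
  assumes "b $ 0 = 0"
  shows "(a oo b) $ n = (\<Sum>k\<in>weight_tuples n.
    a $ (\<Sum>i=1..n. k i) *
      (fact (\<Sum>i=1..n. k i) / (\<Prod>i=1..n. fact (k i)) * (\<Prod>i=1..n. (b $ i) ^ k i)))"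
    (is "_ = (\<Sum>k\<in>_. ?F k)")
proof -
  have "(\<Sum>i=1..n. k i) \<le> n" if "k \<in> weight_tuples n" for k
  proof -
    have "(\<Sum>i=1..n. k i) \<le> (\<Sum>i=1..n. i * k i)"
      by (intro sum_mono) auto
    then show ?thesis
      using that by (simp add: weight_tuples_def)
  qed
  then have "(\<Sum>l=0..n. \<Sum>k\<in>{k \<in> weight_tuples n. (\<Sum>i=1..n. k i) = l}. ?F k) =
      (\<Sum>k\<in>weight_tuples n. ?F k)"
    by (intro sum.group finite_weight_tuples) auto
  moreover have "(a oo b) $ n =
      (\<Sum>l=0..n. \<Sum>k\<in>{k \<in> weight_tuples n. (\<Sum>i=1..n. k i) = l}. ?F k)"
    unfolding fps_compose_nth fps_power_nth_weight_tuples[OF assms] sum_distrib_left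
    by (intro sum.cong refl) auto
  ultimately show ?thesis
    by simp
qed


section \<open>Integer powers as binomial series\<close>

text \<open>
  Composition with \<open>Y\<close> respects products and inverses and sends \<open>1 + X\<close> to \<open>1 + Y\<close>, so the
  case \<open>Y = X\<close> implies the general one.
\<close>
lemma one_plus_powi_eq_binomial_compose:
  fixes Y :: "'a::field_char_0 fps"
  assumes "Y $ 0 = 0"
  shows "(1 + Y) powi c = fps_binomial (of_int c) oo Y"
proof -
  have pow: "(1 + fps_X) ^ j oo Y = (1 + Y) ^ j" for j
    using assms by (simp add: fps_compose_power[symmetric] fps_compose_add_distrib)
  show ?thesis
  proof (cases c rule: int_cases2)
    case (nonneg j)
    then show ?thesis
      by (simp add: fps_binomial_of_nat pow)
  next
    case (nonpos j)
    have "(1 + Y) powi c = inverse ((1 + Y) ^ j)"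
      using nonpos by (cases "j = 0") (auto simp: power_int_def fps_inverse_power)
    also have "\<dots> = inverse ((1 + fps_X) ^ j) oo Y"
      using assms by (simp add: fps_inverse_compose pow fps_nth_power_0)
    finally show ?thesis
      using nonpos by (simp add: fps_binomial_minus_of_nat)
  qed
qed

theorem theorem2p3:
  fixes m :: int and n :: nat
  shows "1 / fact n * gen_bernoulli m n =
    (\<Sum>k\<in>weight_tuples n.
       let l = (\<Sum>i=1..n. k i) in
         (-1) ^ l * ((of_int (m + int l - 1) :: rat) gchoose l)
           * (fact l / (\<Prod>i=1..n. fact (k i)))
           * (\<Prod>i=1..n. (1 / fact (i + 1)) ^ k i))"
proof -
  define Y :: "rat fps" where "Y = Abs_fps (\<lambda>n. if n = 0 then 0 else 1 / fact (n + 1))"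
  have Y0: "Y $ 0 = 0" and Y_nth: "(\<Prod>i=1..n. (Y $ i) ^ k i) = (\<Prod>i=1..n. (1 / fact (i + 1)) ^ k i)"
    for k
    by (auto simp: Y_def intro!: prod.cong)
  have "1 / fact n * gen_bernoulli m n = (fps_binomial (- of_int m) oo Y) $ n"
    using one_plus_powi_eq_binomial_compose[OF Y0, of "- m"]
    by (simp add: gen_bernoulli_def bernoulli_base_def Y_def)
  also have "\<dots> = (\<Sum>k\<in>weight_tuples n.
       let l = (\<Sum>i=1..n. k i) in
         (-1) ^ l * ((of_int (m + int l - 1) :: rat) gchoose l)
           * (fact l / (\<Prod>i=1..n. fact (k i)))
           * (\<Prod>i=1..n. (1 / fact (i + 1)) ^ k i))"
    unfolding fps_compose_nth_weight_tuples[OF Y0] Y_nth Let_def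
    by (intro sum.cong refl) (simp add: gbinomial_minus mult.assoc)
  finally show ?thesis .
qed

end
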